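(* Let $q(\mathbf{x}_0,\mathbf{x}_1)$ be a joint probability distribution on $\mathbb{R}^d\times\mathbb{R}^d$ (an arbitrary coupling of its marginals $q(\mathbf{x}_0)$ and $q(\mathbf{x}_1)$), and for $t\in(0,1)$ let $\mathbf{x}_t=(1-t)\mathbf{x}_0+t\mathbf{x}_1$ with $(\mathbf{x}_0,\mathbf{x}_1)\sim q(\mathbf{x}_0,\mathbf{x}_1)$. Then the flow matching ODE $$d\mathbf{x}_t=\mathbb{E}_{q(\mathbf{x}_0,\mathbf{x}_1\mid\mathbf{x}_t)}[\mathbf{x}_1-\mathbf{x}_0]\,dt$$ is equivalent to the ODE $$d\mathbf{x}_t=t^{-1}\left(\mathbf{x}_t-\mathbb{E}_{q(\mathbf{x}_0\mid\mathbf{x}_t)}[\mathbf{x}_0]\right)dt$$ defined on $t\in(0,1)$; that is, the two velocity fields coincide, so the two ODEs have the same solutions. Hence the solution of the flow matching ODE can be expressed as follows: for $0<s<t<1$, if $u\mapsto\mathbf{x}_u$, $u\in[s,t]$, is the solution trajectory of the flow matching ODE passing through $\mathbf{x}_t$ at time $t$, and $G(\mathbf{x}_t,t,s):=\mathbf{x}_s$ denotes its value at time $s$, then $$G(\mathbf{x}_t,t,s)=\frac{s}{t}\,\mathbf{x}_t+\left(1-\frac{s}{t}\right)g(\mathbf{x}_t,t,s),$$ where $$g(\mathbf{x}_t,t,s)=\mathbf{x}_t+\frac{t}{t-s}\int_t^s u^{-1}\left(\mathbf{x}_u-\mathbb{E}_{q(\mathbf{x}_0\mid\mathbf{x}_u)}[\mathbf{x}_0]\right)du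 .$$
   Context: Given the joint distribution $q(\mathbf{x}_0,\mathbf{x}_1)$, for $t\in(0,1)$ one sets $q(\mathbf{x}_t\mid\mathbf{x}_0,\mathbf{x}_1):=\delta_{(1-t)\mathbf{x}_0+t\mathbf{x}_1}(\mathbf{x}_t)$ (Dirac mass) and $q(\mathbf{x}_t):=\mathbb{E}_{q(\mathbf{x}_0,\mathbf{x}_1)}[q(\mathbf{x}_t\mid\mathbf{x}_0,\mathbf{x}_1)]$, i.e. $q(\mathbf{x}_t)$ is the law of $(1-t)\mathbf{x}_0+t\mathbf{x}_1$. The conditional law of $(\mathbf{x}_0,\mathbf{x}_1)$ given $(1-t)\mathbf{x}_0+t\mathbf{x}_1=\mathbf{x}_t$ is denoted $q(\mathbf{x}_0,\mathbf{x}_1\mid\mathbf{x}_t)$, and $q(\mathbf{x}_0\mid\mathbf{x}_t)$ is its $\mathbf{x}_0$-marginal. Conventions: $q(\mathbf{x}_0,\mathbf{x}_1)$ is such that the conditional expectations appearing are well defined (e.g. $\mathbf{x}_0,\mathbf{x}_1$ have finite first moments); $q(\mathbf{x}_0,\mathbf{x}_1\mid\mathbf{x}_t)$ is a fixed regular conditional distribution that, for every value of $\mathbf{x}_t$, is concentrated on the set $\{(\mathbf{x}_0,\mathbf{x}_1):(1-t)\mathbf{x}_0+t\mathbf{x}_1=\mathbf{x}_t\}$ and under which $\mathbf{x}_0$ and $\mathbf{x}_1$ are integrable; and the ODE solution through $(\mathbf{x}_t,t)$ is assumed to exist and to be unique on $[s,t]$. Solutions are understood in the integral sense, $\mathbf{x}_s=\mathbf{x}_t+\int_t^s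 v(\mathbf{x}_u,u)\,du$, where $v$ is the velocity field. *)

theory Defs
  imports "HOL-Probability.Probability"
begin

definition interpolant :: "real \<Rightarrow> (real ^ 'd) \<times> (real ^ 'd) \<Rightarrow> real ^ 'd" where
  "interpolant t z = (1 - t) *\<^sub>R fst z + t *\<^sub>R snd z"

definition interpolant_law ::
  "((real ^ 'd) \<times> (real ^ 'd)) measure \<Rightarrow> real \<Rightarrow> (real ^ 'd) measure" where
  "interpolant_law q t = distr q borel (interpolant t)"

text \<open>
  \<open>\<kappa>\<close> is a regular conditional distribution of \<open>(x0, x1)\<close> under \<open>q\<close> given the interpolant at
  time \<open>t\<close>. The last two conditions are required at every point \<open>y\<close>, not just almost everywhere,
  and fix a version for which both velocity fields below are defined pointwise.
\<close>

definition conditional_law ::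
  "((real ^ 'd) \<times> (real ^ 'd)) measure \<Rightarrow> real
    \<Rightarrow> (real ^ 'd \<Rightarrow> ((real ^ 'd) \<times> (real ^ 'd)) measure) \<Rightarrow> bool" where
  "conditional_law q t \<kappa> \<longleftrightarrow>
     \<kappa> \<in> borel \<rightarrow>\<^sub>M prob_algebra borel \<and>
     (\<forall>A\<in>sets borel. \<forall>B\<in>sets borel.
        emeasure q (A \<inter> interpolant t -` B)
          = (\<integral>\<^sup>+ y\<in>B. emeasure (\<kappa> y) A \<partial>interpolant_law q t)) \<and>
     (\<forall>y. AE z in \<kappa> y. interpolant t z = y) \<and>
     (\<forall>y. integrable (\<kappa> y) fst \<and> integrable (\<kappa> y) snd)"

definition fst_marginal :: "((real ^ 'd) \<times> (real ^ 'd)) measure \<Rightarrow> (real ^ 'd) measure" where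
  "fst_marginal \<mu> = distr \<mu> borel fst"

text \<open>
  Throughout, \<open>K t y\<close> is the conditional law of \<open>(x0, x1)\<close> given that the interpolant at time
  \<open>t\<close> equals \<open>y\<close>.
\<close>

definition fm_velocity ::
  "(real \<Rightarrow> real ^ 'd \<Rightarrow> ((real ^ 'd) \<times> (real ^ 'd)) measure)
    \<Rightarrow> real ^ 'd \<Rightarrow> real \<Rightarrow> real ^ 'd" where
  "fm_velocity K y t = (\<integral>z. snd z - fst z \<partial>K t y)"

definition x0_velocity ::
  "(real \<Rightarrow> real ^ 'd \<Rightarrow> ((real ^ 'd) \<times> (real ^ 'd)) measure)
    \<Rightarrow> real ^ 'd \<Rightarrow> real \<Rightarrow> real ^ 'd" where
  "x0_velocity K y t = inverse t *\<^sub>R (y - (\<integral>x0. x0 \<partial>fst_marginal (K t y)))"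

text \<open>
  Solutions in the integral sense on an interval \<open>J\<close>. The integral over \<open>u=a..b\<close> is oriented:
  for \<open>b < a\<close> it is minus the integral over \<open>(b, a)\<close>.
\<close>

definition ode_solution ::
  "(real ^ 'd \<Rightarrow> real \<Rightarrow> real ^ 'd) \<Rightarrow> real set \<Rightarrow> (real \<Rightarrow> real ^ 'd) \<Rightarrow> bool" where
  "ode_solution v J x \<longleftrightarrow>
     (\<forall>a\<in>J. \<forall>b\<in>J.
        interval_lebesgue_integrable lebesgue (ereal a) (ereal b) (\<lambda>u. v (x u) u) \<and>
        x b = x a + (LINT u=ereal a..ereal b|lebesgue. (v (x u) u)))"

text \<open>
  A solution on \<open>[s, t]\<close> with value \<open>y\<close> at time \<open>t\<close>. Trajectories are total functions;
  \<^const>\<open>extensional\<close> normalises them outside \<open>[s, t]\<close>, so that uniqueness on \<open>[s, t]\<close> becomes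
  uniqueness of the function.
\<close>

definition solution_through ::
  "(real ^ 'd \<Rightarrow> real \<Rightarrow> real ^ 'd) \<Rightarrow> real ^ 'd \<Rightarrow> real \<Rightarrow> real \<Rightarrow> (real \<Rightarrow> real ^ 'd) \<Rightarrow> bool" where
  "solution_through v y t s x \<longleftrightarrow>
     x \<in> extensional {s..t} \<and> ode_solution v {s..t} x \<and> x t = y"

definition trajectory ::
  "(real ^ 'd \<Rightarrow> real \<Rightarrow> real ^ 'd) \<Rightarrow> real ^ 'd \<Rightarrow> real \<Rightarrow> real \<Rightarrow> real \<Rightarrow> real ^ 'd" where
  "trajectory v y t s = (THE x. solution_through v y t s x)"

definition flow_G ::
  "(real \<Rightarrow> real ^ 'd \<Rightarrow> ((real ^ 'd) \<times> (real ^ 'd)) measure)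
    \<Rightarrow> real ^ 'd \<Rightarrow> real \<Rightarrow> real \<Rightarrow> real ^ 'd" where
  "flow_G K y t s = trajectory (fm_velocity K) y t s s"

definition flow_g ::
  "(real \<Rightarrow> real ^ 'd \<Rightarrow> ((real ^ 'd) \<times> (real ^ 'd)) measure)
    \<Rightarrow> real ^ 'd \<Rightarrow> real \<Rightarrow> real \<Rightarrow> real ^ 'd" where
  "flow_g K y t s =
     (let x = trajectory (fm_velocity K) y t s in
      y + (t / (t - s)) *\<^sub>R
        (LINT u=ereal t..ereal s|lebesgue. (
           inverse u *\<^sub>R (x u - (\<integral>x0. x0 \<partial>fst_marginal (K u (x u)))))))"

end

theory Submission
  imports Defs
begin

text \<open>
  Under \<open>K t y\<close> one has \<open>y = x0 + t (x1 - x0)\<close> almost surely. Integrating this identity gives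
  \<open>t E[x1 - x0] = y - E[x0]\<close>, so the two velocity fields agree pointwise. The formula for \<open>G\<close> is
  then the integral equation from \<open>t\<close> to \<open>s\<close>, since \<open>(1 - s/t) \<cdot> t / (t - s) = 1\<close>.
\<close>

lemma conditional_law_prob_space:
  assumes "conditional_law q t \<kappa>"
  shows "prob_space (\<kappa> y)" "sets (\<kappa> y) = sets borel"
proof -
  have "\<kappa> y \<in> space (prob_algebra borel)"
    using assms by (auto simp: conditional_law_def intro: measurable_space)
  then show "prob_space (\<kappa> y)" "sets (\<kappa> y) = sets borel"
    by (auto simp: space_prob_algebra)
qed

text \<open>Change of variables along the projection: the mean inside \<open>x0_velocity\<close>
  becomes an integral over the joint law, where linearity can relate it to
  \<open>fm_velocity\<close>.\<close>

lemma integral_fst_marginal: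
  assumes "sets \<mu> = sets borel"
  shows "(\<integral>x. x \<partial>fst_marginal \<mu>) = (\<integral>z. fst z \<partial>\<mu>)"
proof -
  have "fst \<in> \<mu> \<rightarrow>\<^sub>M borel"
    using assms by (simp add: measurable_cong_sets[of \<mu> borel] borel_measurable_continuous_onI continuous_on_fst)
  then show ?thesis
    by (simp add: fst_marginal_def integral_distr)
qed

text \<open>Concentration and integrability are available at every \<open>y\<close>, so equality
  holds everywhere. An almost sure version would not suffice, since a single trajectory may stay in
  a null set of the interpolant law.\<close>

lemma fm_velocity_eq_x0_velocity:
  assumes K: "conditional_law q t (K t)" and t: "0 < t"
  shows "fm_velocity K y t = x0_velocity K y t"
proof -
  interpret prob_space "K t y"
    using conditional_law_prob_space(1)[OF K] .
  have integrable [simp]: "integrable (K t y) fst" "integrable (K t y) snd"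
    using K by (auto simp: conditional_law_def)
  have AE: "AE z in K t y. fst z + t *\<^sub>R (snd z - fst z) = y"
    using K by (auto simp: conditional_law_def interpolant_def algebra_simps)
  have "(\<integral>z. fst z + t *\<^sub>R (snd z - fst z) \<partial>K t y) = (\<integral>z. y \<partial>K t y)"
    by (rule integral_cong_AE) (use AE in \<open>auto intro!: borel_measurable_integrable\<close>)
  \<comment> \<open>Linearity splits the left integral; the right one is \<open>y\<close> because
    \<open>K t y\<close> has total mass one.\<close>
  then have "(\<integral>z. fst z \<partial>K t y) + t *\<^sub>R fm_velocity K y t = y"
    by (simp add: fm_velocity_def prob_space)
  then have "y - (\<integral>z. fst z \<partial>K t y) = t *\<^sub>R fm_velocity K y t"
    by (simp add: algebra_simps)
  then show ?thesis
    using t by (simp add: x0_velocity_def integral_fst_marginal conditional_law_prob_space(2)[OF K])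
qed

text \<open>Taking \<open>min\<close> and \<open>max\<close> of the endpoints covers both
  orientations; the formula for \<open>flow_G\<close> integrates backwards, from \<open>t\<close>
  down to \<open>s\<close>.\<close>

lemma interval_lebesgue_integrable_cong:
  assumes "\<And>x. x \<in> einterval (min a b) (max a b) \<Longrightarrow> f x = g x"
  shows "interval_lebesgue_integrable M a b f \<longleftrightarrow> interval_lebesgue_integrable M a b g"
  using assms unfolding interval_lebesgue_integrable_def
  by (auto simp: min_def max_def cong: set_integrable_cong)

lemma interval_lebesgue_integral_cong:
  assumes "\<And>x. x \<in> einterval (min a b) (max a b) \<Longrightarrow> f x = g x"
  shows "interval_lebesgue_integral M a b f = interval_lebesgue_integral M a b g"
  using assms unfolding interval_lebesgue_integral_def set_lebesgue_integral_def
  by (auto simp: indicator_def min_def max_def intro!: Bochner_Integration.integral_cong)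

text \<open>An interval contains all points between any two of its members, so the integrals between
  times in \<open>J\<close> only see the velocity field at times in \<open>J\<close>.\<close>

lemma ode_solution_cong:
  assumes J: "is_interval J" and eq: "\<And>u y. u \<in> J \<Longrightarrow> v y u = w y u"
  shows "ode_solution v J x \<longleftrightarrow> ode_solution w J x"
proof -
  have "v (x u) u = w (x u) u"
    if "a \<in> J" "b \<in> J" "u \<in> einterval (min (ereal a) (ereal b)) (max (ereal a) (ereal b))" for a b u
  proof -
    have "min a b < u" "u < max a b"
      using that(3) by (auto simp: einterval_iff min_def max_def split: if_splits)
    then have "u \<in> J"
      using J that(1,2) unfolding is_interval_1 by (metis less_imp_le max_def min_def)
    then show ?thesis by (rule eq)
  qed
  then have "interval_lebesgue_integrable lebesgue (ereal a) (ereal b) (\<lambda>u. v (x u) u)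
        \<longleftrightarrow> interval_lebesgue_integrable lebesgue (ereal a) (ereal b) (\<lambda>u. w (x u) u)"
      "(LINT u=ereal a..ereal b|lebesgue. v (x u) u) = (LINT u=ereal a..ereal b|lebesgue. w (x u) u)"
    if "a \<in> J" "b \<in> J" for a b
    using that by (auto intro!: interval_lebesgue_integrable_cong interval_lebesgue_integral_cong)
  then show ?thesis
    unfolding ode_solution_def by simp
qed

theorem theorem1:
  fixes q :: "((real ^ 'd) \<times> (real ^ 'd)) measure"
    and K :: "real \<Rightarrow> real ^ 'd \<Rightarrow> ((real ^ 'd) \<times> (real ^ 'd)) measure"
  assumes "prob_space q"
    and "sets q = sets borel"
    and "\<And>t. 0 < t \<Longrightarrow> t < 1 \<Longrightarrow> conditional_law q t (K t)"
  shows "(\<forall>t y. 0 < t \<and> t < 1 \<longrightarrow> fm_velocity K y t = x0_velocity K y t)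
    \<and> (\<forall>J x. is_interval J \<and> J \<subseteq> {0<..<1} \<longrightarrow>
          (ode_solution (fm_velocity K) J x \<longleftrightarrow> ode_solution (x0_velocity K) J x))
    \<and> (\<forall>s t y. 0 < s \<and> s < t \<and> t < 1 \<and> (\<exists>!x. solution_through (fm_velocity K) y t s x) \<longrightarrow>
          flow_G K y t s = (s / t) *\<^sub>R y + (1 - s / t) *\<^sub>R flow_g K y t s)"
proof (intro conjI allI impI; (elim conjE)?)
  show velocity: "fm_velocity K y t = x0_velocity K y t" if "0 < t" "t < 1" for t y
    using fm_velocity_eq_x0_velocity assms(3) that by blast
  show ode: "ode_solution (fm_velocity K) J x \<longleftrightarrow> ode_solution (x0_velocity K) J x"
    if "is_interval J" "J \<subseteq> {0<..<1}" for J x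
    using that velocity by (intro ode_solution_cong) auto
  show "flow_G K y t s = (s / t) *\<^sub>R y + (1 - s / t) *\<^sub>R flow_g K y t s"
    if st: "0 < s" "s < t" "t < 1" and unique: "\<exists>!x. solution_through (fm_velocity K) y t s x"
    for s t y
  proof -
    define x where "x = trajectory (fm_velocity K) y t s"
    define I where "I = (LINT u=ereal t..ereal s|lebesgue. x0_velocity K (x u) u)"
    \<comment> \<open>Unique existence ensures that the description defining
      \<open>trajectory\<close> denotes an actual solution.\<close>
    have "solution_through (fm_velocity K) y t s x"
      unfolding x_def trajectory_def using unique by (rule theI')
    then have "ode_solution (x0_velocity K) {s..t} x" and "x t = y"
      using ode[of "{s..t}" x] st by (auto simp: solution_through_def is_interval_cc subset_iff)
    \<comment> \<open>The integral equation with \<open>a = t\<close> and \<open>b = s\<close>; the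
      integral is oriented, so \<open>I\<close> enters with a plus sign.\<close>
    then have "x s = y + I"
      using st by (auto simp: ode_solution_def I_def)
    moreover have "flow_g K y t s = y + (t / (t - s)) *\<^sub>R I"
      by (simp add: flow_g_def Let_def x_def I_def x0_velocity_def)
    moreover have "(1 - s / t) * (t / (t - s)) = 1"
      using st by (simp add: field_simps)
    \<comment> \<open>The restricted rewriting first collects the coefficient of \<open>I\<close>
      into the product just shown to be 1; the weights of \<open>y\<close> then add up to 1.\<close>
    ultimately have "(s / t) *\<^sub>R y + (1 - s / t) *\<^sub>R flow_g K y t s = x s"
      by (simp only: scaleR_add_right scaleR_scaleR scaleR_one) (simp add: algebra_simps)
    then show ?thesis
      by (simp add: flow_G_def x_def)
  qed
qed

end
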